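(* For $n\geq 0$, $\mathrm{pspa}(2n+1)+\mathrm{pspa}(4n+1)+\mathrm{pspa}(8n+1)\equiv 0 \pmod 2$ if and only if $n\equiv 0, 4,$ or $5 \pmod 7$.
   Context: For $n\ge1$, $\mathrm{pspa}(n)$ denotes the total number of parts (counted with multiplicity) in all the partitions in $\mathcal{SP}a(n)$, the set of semi-Padovan partitions of $n$, defined as follows. A partition of $n$ is a weakly decreasing sequence (equivalently, a finite multiset) of positive integers with sum $n$. $\lambda\sqcup\mu$ is the partition whose multiset of parts is the multiset union (multiplicities added) of the parts of $\lambda$ and $\mu$; $2\lambda$ is obtained by doubling every part; if $\lambda$ has an odd part, $\lambda^{o+2}$ is obtained by adding $2$ to (one occurrence of) the largest odd part of $\lambda$. These operations are applied elementwise to sets of partitions (giving $\emptyset$ for the empty set). $\mathcal{SP}a(0)=\{(\,)\}$ (the set containing the empty partition), $\mathcal{SP}a(1)=\emptyset$, $\mathcal{SP}a(3)=\{(3)\}$, $\mathcal{SP}a(2n)=2\,\mathcal{SP}a(n)$ for $n\ge1$, and $\mathcal{SP}a(2n+1)=\mathcal{SP}a(2n-1)^{o+2}\cup\big(\mathcal{SP}a(2n-2)\sqcup(1,1,1)\big)$ for $n\ge2$. *)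

theory Defs
  imports "HOL-Library.Multiset" "HOL-Number_Theory.Cong"
begin

text \<open>A partition is represented by the finite multiset of its (positive) parts.\<close>

definition dbl :: "nat multiset \<Rightarrow> nat multiset" where
  "dbl p = image_mset (\<lambda>x. 2 * x) p"

definition largest_odd :: "nat multiset \<Rightarrow> nat" where
  "largest_odd p = Max {x. x \<in># p \<and> odd x}"

text \<open>The operation \<open>\<lambda>\<^sup>o\<^sup>+\<^sup>2\<close>; meaningful only if \<open>p\<close> has an odd part.
  It is applied below only to partitions of odd numbers, which always have one
  (see \<open>SPa_odd_has_odd_part\<close>).\<close>

definition odd_plus2 :: "nat multiset \<Rightarrow> nat multiset" where
  "odd_plus2 p = add_mset (largest_odd p + 2) (p - {#largest_odd p#})"

function SPa :: "nat \<Rightarrow> nat multiset set" where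
  "SPa 0 = {{#}}"
| "SPa (Suc 0) = {}"
| "SPa 3 = {{#3#}}"
| "n \<ge> 1 \<Longrightarrow> SPa (2 * n) = dbl ` SPa n"
| "n \<ge> 2 \<Longrightarrow> SPa (2 * n + 1) =
     odd_plus2 ` SPa (2 * n - 1) \<union> (\<lambda>p. p + {#1, 1, 1#}) ` SPa (2 * n - 2)"
proof -
  fix P :: bool and x :: nat
  assume a: "x = 0 \<Longrightarrow> P" "x = Suc 0 \<Longrightarrow> P" "x = 3 \<Longrightarrow> P"
    "\<And>n. n \<ge> 1 \<Longrightarrow> x = 2 * n \<Longrightarrow> P" "\<And>n. n \<ge> 2 \<Longrightarrow> x = 2 * n + 1 \<Longrightarrow> P"
  show P
  proof (cases "even x")
    case True
    then obtain k where "x = 2 * k" by (elim evenE)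
    then show P using a(1) a(4)[of k] by (cases "k = 0") auto
  next
    case False
    then obtain k where k: "x = 2 * k + 1" by (elim oddE)
    consider "k = 0" | "k = 1" | "k \<ge> 2" by linarith
    then show P using a(2,3) a(5)[of k] k by cases auto
  qed
next
  fix n m :: nat
  assume "2 * n = 2 * m + 1"
  then have False by presburger
  then show "dbl ` SPa_sumC n = odd_plus2 ` SPa_sumC (2 * m - 1) \<union>
      (\<lambda>p. p + {#1, 1, 1#}) ` SPa_sumC (2 * m - 2)" ..
next
  fix n :: nat
  assume "3 = 2 * n"
  then have False by presburger
  then show "{{#3#}} = dbl ` SPa_sumC n" ..
next
  fix n :: nat
  assume "Suc 0 = 2 * n"
  then have False by presburger
  then show "{} = dbl ` SPa_sumC n" ..
qed simp_all
termination by (relation "measure id") auto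

definition pspa :: "nat \<Rightarrow> nat" where
  "pspa n = (\<Sum>p\<in>SPa n. size p)"

text \<open>Sanity checks: the sum above ranges over a finite set, and the elements of
  \<open>SPa n\<close> are partitions of \<open>n\<close>.\<close>

lemma finite_SPa: "finite (SPa n)"
proof (induction n rule: SPa.induct)
  case (5 n)
  then show ?case by (subst SPa.simps(5)) auto
qed auto

lemma odd_sum_mset_has_odd:
  "odd (\<Sum>\<^sub># p) \<Longrightarrow> \<exists>x. x \<in># p \<and> odd x" for p :: "nat multiset"
  by (induction p) auto

lemma largest_odd_in:
  assumes "odd (\<Sum>\<^sub># p)"
  shows "largest_odd p \<in># p" "odd (largest_odd p)"
proof -
  have "Max {x. x \<in># p \<and> odd x} \<in> {x. x \<in># p \<and> odd x}"
    using odd_sum_mset_has_odd[OF assms] by (intro Max_in) auto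
  then show "largest_odd p \<in># p" "odd (largest_odd p)"
    unfolding largest_odd_def by auto
qed

lemma sum_mset_dbl: "\<Sum>\<^sub># (dbl p) = 2 * \<Sum>\<^sub># p"
  by (induction p) (simp_all add: dbl_def)

lemma sum_mset_odd_plus2:
  assumes "odd (\<Sum>\<^sub># p)"
  shows "\<Sum>\<^sub># (odd_plus2 p) = \<Sum>\<^sub># p + 2"
proof -
  have "p = add_mset (largest_odd p) (p - {#largest_odd p#})"
    using largest_odd_in(1)[OF assms] by simp
  then have "\<Sum>\<^sub># p = largest_odd p + \<Sum>\<^sub># (p - {#largest_odd p#})"
    by (metis sum_mset.add_mset)
  then show ?thesis
    unfolding odd_plus2_def by simp
qed

lemma SPa_partition:
  "p \<in> SPa n \<Longrightarrow> \<Sum>\<^sub># p = n \<and> (\<forall>x\<in>#p. x > 0)"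
proof (induction n arbitrary: p rule: SPa.induct)
  case (4 n)
  from 4(3)[unfolded SPa.simps(4)[OF 4(1)]] obtain q where q: "q \<in> SPa n" "p = dbl q" by blast
  have "\<forall>x\<in>#dbl q. x > 0" using 4(2)[OF q(1)] by (auto simp: dbl_def)
  then show ?case using 4(2)[OF q(1)] q(2) sum_mset_dbl[of q] by simp
next
  case (5 n)
  from 5(4)[unfolded SPa.simps(5)[OF 5(1)]] consider
      q where "q \<in> SPa (2 * n - 1)" "p = odd_plus2 q"
    | q where "q \<in> SPa (2 * n - 2)" "p = q + {#1, 1, 1#}"
    by auto
  then show ?case
  proof cases
    case 1
    have q: "\<Sum>\<^sub># q = 2 * n - 1" "\<forall>x\<in>#q. x > 0" using 5(2)[OF 1(1)] by auto
    have "odd (\<Sum>\<^sub># q)" using q 5(1) by simp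
    then show ?thesis using q sum_mset_odd_plus2[of q] 5(1) 1(2)
      by (auto simp: odd_plus2_def dest: in_diffD)
  next
    case 2
    then show ?thesis using 5(3)[OF 2(1)] 5(1) by auto
  qed
qed auto

lemma SPa_odd_has_odd_part:
  "p \<in> SPa n \<Longrightarrow> odd n \<Longrightarrow> \<exists>x. x \<in># p \<and> odd x"
  using SPa_partition[of p n] odd_sum_mset_has_odd[of p] by auto

end

theory Submission
  imports Defs
begin

text \<open>
  Write \<open>s n\<close> for the number of semi-Padovan partitions of \<open>n\<close> and \<open>p n\<close> for \<open>pspa n\<close>. The two
  pieces in the recursion for odd arguments are disjoint (in the first one the largest odd part is
  at least \<open>3\<close>, in the second one it is \<open>1\<close>), and \<open>\<lambda> \<mapsto> \<lambda>\<^sup>o\<^sup>+\<^sup>2\<close>, like doubling, is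
  injective and keeps the number of parts. Hence \<open>s (2n) = s n\<close>, \<open>p (2n) = p n\<close> and, for \<open>n \<ge> 1\<close>,
  \<open>s (2n+1) = s (2n-1) + s (n-1)\<close> and \<open>p (2n+1) \<equiv> p (2n-1) + p (n-1) + s (n-1)\<close> modulo \<open>2\<close>
  (lemmas \<open>card_SPa_odd\<close> and \<open>even_pspa_odd\<close>).

  Put \<open>d n = p (2n+1) + p (4n+1) + p (8n+1)\<close>. Express \<open>d (n+1)\<close> through \<open>d n\<close> by one, two and
  four applications of the odd recursion to the three summands. Modulo \<open>2\<close> every value of
  \<open>p\<close> in the difference cancels, since \<open>p\<close> and \<open>s\<close> are invariant under doubling, and what is left
  is \<open>s n\<close>. As \<open>s (2n+3) - s (2n+1)\<close> is \<open>s n\<close> too, the congruence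
  \<open>d n \<equiv> s (2n+1)\<close> propagates from \<open>d 0 = 0 = s 1\<close> to all \<open>n\<close> (lemma \<open>even_pspa_triple_iff\<close>).

  The parity of \<open>s\<close> is periodic: modulo \<open>2\<close> its generating function is \<open>(1+x\<^sup>2)/(1+x\<^sup>2+x\<^sup>3)\<close>, and
  the denominator divides \<open>1+x\<^sup>7\<close>. Once the residues \<open>0, 3, 5, 6\<close> modulo \<open>7\<close> with \<open>s\<close> odd
  are known, the recursion confirms them by strong induction (lemma
  \<open>odd_card_SPa_iff\<close>). The number \<open>2n+1\<close> avoids these residues exactly if \<open>n\<close> is congruent to \<open>0\<close>, \<open>4\<close> or \<open>5\<close>.
\<close>

section \<open>Raising the largest odd part\<close>

lemma largest_odd_odd_plus2:
  assumes "odd (\<Sum>\<^sub># p)"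
  shows "largest_odd (odd_plus2 p) = largest_odd p + 2"
proof -
  have le: "x \<le> largest_odd p" if "x \<in># p" "odd x" for x
    using that unfolding largest_odd_def by (intro Max_ge) auto
  show ?thesis
    unfolding largest_odd_def[of "odd_plus2 p"]
  proof (rule Max_eqI)
    show "finite {x. x \<in># odd_plus2 p \<and> odd x}"
      by simp
    show "y \<le> largest_odd p + 2" if "y \<in> {x. x \<in># odd_plus2 p \<and> odd x}" for y
      using that le[of y] by (auto simp: odd_plus2_def dest: in_diffD)
    show "largest_odd p + 2 \<in> {x. x \<in># odd_plus2 p \<and> odd x}"
      using largest_odd_in(2)[OF assms] by (simp add: odd_plus2_def)
  qed
qed

text \<open>The raised part is again the largest odd part, so subtracting \<open>2\<close> from the largest odd
  part undoes the operation.\<close>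

lemma inj_on_odd_plus2: "inj_on odd_plus2 {p. odd (\<Sum>\<^sub># p)}"
proof (rule inj_onI)
  fix p q :: "nat multiset"
  assume "p \<in> {p. odd (\<Sum>\<^sub># p)}" "q \<in> {p. odd (\<Sum>\<^sub># p)}" and eq: "odd_plus2 p = odd_plus2 q"
  then have p: "odd (\<Sum>\<^sub># p)" and q: "odd (\<Sum>\<^sub># q)"
    by auto
  have l: "largest_odd p = largest_odd q"
    using largest_odd_odd_plus2[OF p] largest_odd_odd_plus2[OF q] eq by simp
  then have "p - {#largest_odd p#} = q - {#largest_odd p#}"
    using eq by (simp add: odd_plus2_def)
  then show "p = q"
    using largest_odd_in(1)[OF p] largest_odd_in(1)[OF q] l by (metis insert_DiffM)
qed

lemma size_odd_plus2:
  assumes "odd (\<Sum>\<^sub># p)"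
  shows "size (odd_plus2 p) = size p"
  using largest_odd_in(1)[OF assms] by (metis insert_DiffM odd_plus2_def size_add_mset)

section \<open>Recursions for the number of partitions and the number of parts\<close>

lemma inj_dbl: "inj dbl"
  unfolding dbl_def by (intro injI) (auto elim!: multiset.inj_map_strong[rotated])

lemma SPa_double: "SPa (2 * n) = dbl ` SPa n"
  by (cases "n = 0") (simp_all add: dbl_def)

lemma card_SPa_double: "card (SPa (2 * n)) = card (SPa n)"
  unfolding SPa_double by (rule card_image) (rule inj_on_subset[OF inj_dbl], simp)

lemma pspa_double: "pspa (2 * n) = pspa n"
  unfolding pspa_def SPa_double
  by (subst sum.reindex) (auto intro: inj_on_subset[OF inj_dbl] simp: dbl_def)

lemma largest_odd_append_ones:
  assumes "p \<in> SPa (2 * m)"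
  shows "largest_odd (p + {#1, 1, 1#}) = 1"
proof -
  have "even x" if "x \<in># p" for x
    using assms that unfolding SPa_double dbl_def by auto
  then have "{x. x \<in># p + {#1, 1, 1#} \<and> odd x} = {1}"
    by auto
  then show ?thesis
    unfolding largest_odd_def by simp
qed

text \<open>Raising the largest odd part never makes it \<open>1\<close>, whereas \<open>1\<close> is the largest odd part after
  appending \<open>(1,1,1)\<close>; so the two pieces are disjoint. Taking \<open>f\<close> constant gives the recursion for
  the number of partitions, and \<open>f = size\<close> gives the one for the number of parts.\<close>

lemma sum_SPa_odd:
  fixes f :: "nat multiset \<Rightarrow> nat"
  assumes "m \<ge> 1"
  shows "(\<Sum>p\<in>SPa (2 * m + 3). f p) =
    (\<Sum>p\<in>SPa (2 * m + 1). f (odd_plus2 p)) + (\<Sum>p\<in>SPa m. f (dbl p + {#1, 1, 1#}))"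
proof -
  let ?A = "SPa (2 * m + 1)" and ?B = "SPa (2 * m)" and ?g = "\<lambda>p. p + {#1, 1, 1::nat#}"
  have oddA: "?A \<subseteq> {p. odd (\<Sum>\<^sub># p)}"
    using SPa_partition by auto
  have step: "SPa (2 * m + 3) = odd_plus2 ` ?A \<union> ?g ` ?B"
    using SPa.simps(5)[of "m + 1"] assms by (simp add: algebra_simps numeral_3_eq_3)
  have disj: "odd_plus2 ` ?A \<inter> ?g ` ?B = {}"
  proof -
    have False if "a \<in> ?A" "b \<in> ?B" "odd_plus2 a = ?g b" for a b
    proof -
      have "odd (\<Sum>\<^sub># a)"
        using oddA that(1) by auto
      then show False
        using largest_odd_odd_plus2[of a] largest_odd_append_ones[OF that(2)] that(3) by simp
    qed
    then show ?thesis
      by blast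
  qed
  have "sum f (SPa (2 * m + 3)) = sum f (odd_plus2 ` ?A) + sum f (?g ` ?B)"
    unfolding step by (rule sum.union_disjoint) (use disj finite_SPa in auto)
  also have "sum f (odd_plus2 ` ?A) = (\<Sum>p\<in>?A. f (odd_plus2 p))"
    using inj_on_subset[OF inj_on_odd_plus2 oddA] by (simp add: sum.reindex)
  also have "sum f (?g ` ?B) = (\<Sum>p\<in>?B. f (?g p))"
    by (subst sum.reindex) (auto intro!: inj_onI)
  also have "\<dots> = (\<Sum>p\<in>SPa m. f (?g (dbl p)))"
    unfolding SPa_double by (subst sum.reindex) (auto intro: inj_on_subset[OF inj_dbl])
  finally show ?thesis .
qed

lemma card_SPa_odd: "card (SPa (2 * m + 3)) = card (SPa (2 * m + 1)) + card (SPa m)"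
proof (cases "m = 0")
  case False
  then show ?thesis
    using sum_SPa_odd[of m "\<lambda>_. 1"] by simp
qed simp

lemma pspa_odd:
  assumes "m \<ge> 1"
  shows "pspa (2 * m + 3) = pspa (2 * m + 1) + pspa m + 3 * card (SPa m)"
proof -
  have "(\<Sum>p\<in>SPa (2 * m + 1). size (odd_plus2 p)) = pspa (2 * m + 1)"
    unfolding pspa_def using SPa_partition by (intro sum.cong size_odd_plus2) auto
  moreover have "(\<Sum>p\<in>SPa m. size (dbl p + {#1, 1, 1#})) = pspa m + 3 * card (SPa m)"
    unfolding pspa_def by (simp add: dbl_def sum_Suc)
  ultimately show ?thesis
    using sum_SPa_odd[OF assms, of size] by (simp add: pspa_def)
qed

text \<open>The exact recursion fails at \<open>m = 0\<close>: the only semi-Padovan partition of \<open>3\<close> is \<open>(3)\<close>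
  and not \<open>(1,1,1)\<close>. Both have an odd number of parts, so the parity does not notice.\<close>

lemma even_pspa_odd:
  "even (pspa (2 * m + 3)) \<longleftrightarrow> even (pspa (2 * m + 1) + pspa m + card (SPa m))"
proof (cases "m = 0")
  case True
  then show ?thesis
    by (simp add: pspa_def)
next
  case False
  then show ?thesis
    using pspa_odd[of m] by simp
qed

section \<open>Parities\<close>

lemma residue_mod_7_cases:
  fixes m :: nat
  obtains "m mod 7 = 0" | "m mod 7 = 1" | "m mod 7 = 2" | "m mod 7 = 3" | "m mod 7 = 4"
    | "m mod 7 = 5" | "m mod 7 = 6"
proof -
  have "m mod 7 < 7"
    by simp
  then show ?thesis
    using that by linarith
qed

lemma affine_mod_7: "(a * m + b) mod 7 = (a * (m mod 7) + b) mod 7" for a m b :: nat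
  by (metis mod_add_left_eq mod_mult_right_eq)

lemma odd_card_SPa_iff: "odd (card (SPa n)) \<longleftrightarrow> n mod 7 \<in> {0, 3, 5, 6}"
proof (induction n rule: less_induct)
  case (less n)
  consider "n = 0" | "n = 1" | k where "n = 2 * k" "k \<ge> 1" | m where "n = 2 * m + 3"
  proof (cases "even n")
    case True
    then obtain k where "n = 2 * k" by (elim evenE)
    then show ?thesis using that(1,3) by (cases "k = 0") auto
  next
    case False
    then obtain k where k: "n = 2 * k + 1" by (elim oddE)
    then show ?thesis using that(2) that(4)[of "k - 1"] by (cases "k = 0") auto
  qed
  then show ?case
  proof cases
    case (3 k)
    have "odd (card (SPa n)) \<longleftrightarrow> k mod 7 \<in> {0, 3, 5, 6}"
      using less[of k] 3 card_SPa_double[of k] by simp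
    also have "\<dots> \<longleftrightarrow> n mod 7 \<in> {0, 3, 5, 6}"
      using affine_mod_7[of 2 k 0] 3(1) by (cases k rule: residue_mod_7_cases) simp_all
    finally show ?thesis .
  next
    case (4 m)
    have "odd (card (SPa n)) \<longleftrightarrow>
        ((2 * m + 1) mod 7 \<in> {0, 3, 5, 6}) \<noteq> (m mod 7 \<in> {0, 3, 5, 6})"
      using less[of "2 * m + 1"] less[of m] 4 card_SPa_odd[of m] by auto
    also have "\<dots> \<longleftrightarrow> n mod 7 \<in> {0, 3, 5, 6}"
      unfolding 4 affine_mod_7[of 2 m] by (cases m rule: residue_mod_7_cases) simp_all
    finally show ?thesis .
  qed simp_all
qed

lemma even_pspa_triple_iff:
  "even (pspa (2 * n + 1) + pspa (4 * n + 1) + pspa (8 * n + 1)) \<longleftrightarrow> even (card (SPa (2 * n + 1)))"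
proof (induction n)
  case 0
  show ?case
    by (simp add: pspa_def)
next
  case (Suc n)
  have step: "even (pspa k) \<longleftrightarrow> even (pspa l + pspa m + card (SPa m))"
    if "k = 2 * m + 3" "l = 2 * m + 1" for k l m
    unfolding that by (rule even_pspa_odd)
  have p_double: "pspa k = pspa m" and s_double: "card (SPa k) = card (SPa m)"
    if "k = 2 * m" for k m
    unfolding that by (rule pspa_double card_SPa_double)+
  have double: "pspa (2 * n) = pspa n" "card (SPa (2 * n)) = card (SPa n)"
    "pspa (4 * n) = pspa n" "card (SPa (4 * n)) = card (SPa n)"
    "pspa (4 * n + 2) = pspa (2 * n + 1)" "card (SPa (4 * n + 2)) = card (SPa (2 * n + 1))"
    using p_double[of "2 * n" n] s_double[of "2 * n" n]
      p_double[of "4 * n" "2 * n"] s_double[of "4 * n" "2 * n"]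
      p_double[of "4 * n + 2" "2 * n + 1"] s_double[of "4 * n + 2" "2 * n + 1"] by simp_all
  have p2: "even (pspa (2 * n + 3)) \<longleftrightarrow> even (pspa (2 * n + 1) + pspa n + card (SPa n))"
    by (rule even_pspa_odd)
  have p4a: "even (pspa (4 * n + 3)) \<longleftrightarrow> even (pspa (4 * n + 1) + pspa n + card (SPa n))"
    using step[of "4 * n + 3" "2 * n" "4 * n + 1"] by (simp add: double)
  have p4b: "even (pspa (4 * n + 5)) \<longleftrightarrow>
      even (pspa (4 * n + 3) + pspa (2 * n + 1) + card (SPa (2 * n + 1)))"
    using step[of "4 * n + 5" "2 * n + 1" "4 * n + 3"] by simp
  have p8a: "even (pspa (8 * n + 3)) \<longleftrightarrow> even (pspa (8 * n + 1) + pspa n + card (SPa n))"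
    using step[of "8 * n + 3" "4 * n" "8 * n + 1"] by (simp add: double)
  have p8b: "even (pspa (8 * n + 5)) \<longleftrightarrow>
      even (pspa (8 * n + 3) + pspa (4 * n + 1) + card (SPa (4 * n + 1)))"
    using step[of "8 * n + 5" "4 * n + 1" "8 * n + 3"] by simp
  have p8c: "even (pspa (8 * n + 7)) \<longleftrightarrow>
      even (pspa (8 * n + 5) + pspa (2 * n + 1) + card (SPa (2 * n + 1)))"
    using step[of "8 * n + 7" "4 * n + 2" "8 * n + 5", unfolded double] by simp
  have p8d: "even (pspa (8 * n + 9)) \<longleftrightarrow>
      even (pspa (8 * n + 7) + pspa (4 * n + 3) + card (SPa (4 * n + 3)))"
    using step[of "8 * n + 9" "4 * n + 3" "8 * n + 7"] by simp
  have s2: "card (SPa (2 * n + 3)) = card (SPa (2 * n + 1)) + card (SPa n)"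
    by (rule card_SPa_odd)
  have s4: "card (SPa (4 * n + 3)) = card (SPa (4 * n + 1)) + card (SPa n)"
    using card_SPa_odd[of "2 * n"] by (simp add: double)
  \<comment> \<open>The values at \<open>4n+1\<close> and \<open>4n+3\<close> that \<open>p8b\<close> and \<open>p8d\<close> contribute differ by one more
    step of the recursion, \<open>p4a\<close> and \<open>s4\<close>; this is what makes the values of \<open>pspa\<close> cancel.\<close>
  have "even (pspa (2 * n + 3) + pspa (4 * n + 5) + pspa (8 * n + 9)) \<longleftrightarrow>
      even (card (SPa (2 * n + 3)))"
    using Suc.IH p2 p4a p4b p8a p8b p8c p8d unfolding s2 s4 even_add by argo
  moreover have "2 * Suc n + 1 = 2 * n + 3" "4 * Suc n + 1 = 4 * n + 5" "8 * Suc n + 1 = 8 * n + 9"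
    by simp_all
  ultimately show ?case
    by (simp only:)
qed

theorem theorem5p11:
  fixes n :: nat
  shows "[pspa (2 * n + 1) + pspa (4 * n + 1) + pspa (8 * n + 1) = 0] (mod 2) \<longleftrightarrow>
    [n = 0] (mod 7) \<or> [n = 4] (mod 7) \<or> [n = 5] (mod 7)"
proof -
  have "[pspa (2 * n + 1) + pspa (4 * n + 1) + pspa (8 * n + 1) = 0] (mod 2) \<longleftrightarrow>
      even (pspa (2 * n + 1) + pspa (4 * n + 1) + pspa (8 * n + 1))"
    by (simp add: cong_0_iff)
  also have "\<dots> \<longleftrightarrow> (2 * n + 1) mod 7 \<notin> {0, 3, 5, 6}"
    unfolding even_pspa_triple_iff odd_card_SPa_iff[symmetric] by simp
  also have "\<dots> \<longleftrightarrow> [n = 0] (mod 7) \<or> [n = 4] (mod 7) \<or> [n = 5] (mod 7)"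
    unfolding cong_def affine_mod_7[of 2 n] by (cases n rule: residue_mod_7_cases) simp_all
  finally show ?thesis .
qed

end
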